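(* Let $\mathcal{P}_1,\mathcal{P}_2\subset\mathbb{R}^n$ be full-dimensional anti-blocking polytopes. Then \[(\mathcal{P}_1-\mathcal{P}_2)^\triangle=\operatorname{conv}\big(A(\mathcal{P}_1)\cup -A(\mathcal{P}_2)\big),\] and moreover \[\big(\operatorname{conv}(2\mathcal{P}_1\times\{1\}\cup -2\mathcal{P}_2\times\{-1\})\big)^\triangle=\operatorname{conv}\big(-A(\mathcal{P}_2)\times\{1\}\cup A(\mathcal{P}_1)\times\{-1\}\big).\]
   Context: A polytope $\mathcal{P}\subseteq\mathbb{R}^n_{\ge0}$ is anti-blocking if $q\in\mathcal{P}$ and $0\le p\le q$ (componentwise) imply $p\in\mathcal{P}$. For a polytope $\mathcal{Q}\subseteq\mathbb{R}^n_{\ge0}$, its associated anti-blocking polytope is $A(\mathcal{Q})=\{d\in\mathbb{R}^n_{\ge0}:\langle d,x\rangle\le1\text{ for all }x\in\mathcal{Q}\}$. The polar of $S\subseteq\mathbb{R}^m$ is $S^\triangle=\{y:\langle y,s\rangle\le1\ \forall s\in S\}$ (dual space identified with $\mathbb{R}^m$ via the standard inner product). $\mathcal{P}_1-\mathcal{P}_2$ is the Minkowski difference. *)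

theory Defs
  imports "HOL-Analysis.Analysis"
begin

text \<open>
  The order on \<^typ>\<open>real ^ 'n\<close> is the componentwise one, so \<^prop>\<open>0 \<le> (x :: real ^ 'n)\<close> says that
  \<open>x\<close> lies in the nonnegative orthant. On sets, \<open>-\<close> is complement and difference in the library;
  the negative of a set is therefore written \<open>uminus ` S\<close>, the dilate \<open>(*\<^sub>R) c ` S\<close>, and the
  Minkowski difference is a separate constant.
\<close>

definition anti_blocking_polytope :: "(real ^ 'n) set \<Rightarrow> bool" where
  "anti_blocking_polytope P \<longleftrightarrow>
     polytope P \<and> (\<forall>x\<in>P. 0 \<le> x) \<and> (\<forall>q\<in>P. \<forall>p. 0 \<le> p \<and> p \<le> q \<longrightarrow> p \<in> P)"

definition assoc_anti_blocking :: "(real ^ 'n) set \<Rightarrow> (real ^ 'n) set" where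
  "assoc_anti_blocking Q = {d. 0 \<le> d \<and> (\<forall>x\<in>Q. d \<bullet> x \<le> 1)}"

definition polar :: "'a::real_inner set \<Rightarrow> 'a set" where
  "polar S = {y. \<forall>s\<in>S. y \<bullet> s \<le> 1}"

definition minkowski_diff :: "'a::ab_group_add set \<Rightarrow> 'a set \<Rightarrow> 'a set" where
  "minkowski_diff S T = {s - t | s t. s \<in> S \<and> t \<in> T}"

end

theory Submission
  imports Defs
begin

text \<open>
  Split \<open>y\<close> into its positive and negative parts. On an anti-blocking set, the maximum of
  \<open>\<langle>y, _\<rangle>\<close> equals that of \<open>\<langle>y\<^sup>+, _\<rangle>\<close>, because the coordinates where \<open>y\<close> is negative may be set
  to zero. Full dimension makes this maximum vanish only if \<open>y\<^sup>+ = 0\<close>, so \<open>\<langle>y, _\<rangle> \<le> c\<close> on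
  \<open>P\<close> gives \<open>y\<^sup>+ \<in> c A(P)\<close>. Both polars consist of points with bounds \<open>\<langle>y, _\<rangle> \<le> c\<close> on \<open>P\<^sub>1\<close>
  and \<open>\<langle>-y, _\<rangle> \<le> 1 - c\<close> on \<open>P\<^sub>2\<close>, and \<open>y = y\<^sup>+ - y\<^sup>-\<close> is then the required convex combination;
  in the second identity the last coordinate \<open>1 - 2c\<close> records \<open>c\<close>.
\<close>

definition pos_part :: "real ^ 'n \<Rightarrow> real ^ 'n" where
  "pos_part y = (\<chi> i. max 0 (y $ i))"

lemma pos_part_nonneg: "0 \<le> pos_part y"
  by (simp add: pos_part_def less_eq_vec_def)

lemma pos_part_diff: "pos_part y - pos_part (- y) = y"
  by (simp add: pos_part_def vec_eq_iff max_def)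

lemma inner_nonneg_vec:
  fixes x y :: "real ^ 'n"
  assumes "0 \<le> x" "0 \<le> y"
  shows "0 \<le> x \<bullet> y"
  using assms by (auto simp: inner_vec_def less_eq_vec_def intro!: sum_nonneg)

text \<open>Otherwise \<open>P\<close> would lie in the hyperplane where coordinate \<open>i\<close>
  vanishes, whose dimension is one too small.\<close>

lemma full_dim_obtains_pos_coord:
  fixes P :: "(real ^ 'n) set"
  assumes "aff_dim P = int CARD('n)" "\<forall>x\<in>P. 0 \<le> x"
  obtains x where "x \<in> P" "0 < x $ i"
proof (rule ccontr)
  assume "\<not> thesis"
  then have "\<forall>x\<in>P. x $ i = 0"
    using assms(2) that by (metis less_eq_vec_def zero_index order_le_less)
  then have "P \<subseteq> {x. axis i 1 \<bullet> x = 0}"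
    by (auto simp: inner_axis')
  then have "aff_dim P \<le> aff_dim {x :: real ^ 'n. axis i 1 \<bullet> x = 0}"
    by (rule aff_dim_subset)
  also have "\<dots> = int CARD('n) - 1"
    by (subst aff_dim_hyperplane) (auto simp: axis_eq_0_iff)
  finally show False
    using assms(1) by simp
qed

lemma zero_mem_anti_blocking:
  fixes P :: "(real ^ 'n) set"
  assumes "anti_blocking_polytope P" "aff_dim P = int CARD('n)"
  shows "0 \<in> P"
proof -
  have "P \<noteq> {}"
    using assms(2) by auto
  then show ?thesis
    using assms(1) unfolding anti_blocking_polytope_def by blast
qed

lemma pos_part_inner_le:
  assumes "anti_blocking_polytope P" "\<forall>s\<in>P. y \<bullet> s \<le> c" "x \<in> P"
  shows "pos_part y \<bullet> x \<le> c"
proof -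
  \<comment> \<open>Dropping the coordinates of \<open>x\<close> where \<open>y\<close> is not
    positive stays below \<open>x\<close>, hence in \<open>P\<close>, and turns \<open>y\<close>
    into its positive part in the inner product.\<close>
  define s where "s = (\<chi> i. if 0 < y $ i then x $ i else 0)"
  have "0 \<le> x"
    using assms(1,3) by (simp add: anti_blocking_polytope_def)
  then have "0 \<le> s \<and> s \<le> x"
    by (auto simp: s_def less_eq_vec_def)
  then have "s \<in> P"
    using assms(1,3) unfolding anti_blocking_polytope_def by blast
  moreover have "pos_part y \<bullet> x = y \<bullet> s"
    unfolding inner_vec_def by (rule sum.cong) (auto simp: s_def pos_part_def)
  ultimately show ?thesis
    using assms(2) by simp
qed

text \<open>The multiple \<open>c *\<^sub>R d\<close> replaces division by \<open>c\<close>, so that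
  \<open>c = 0\<close> is covered: there the positive part must vanish, and \<open>d = 0\<close>
  serves.\<close>

lemma pos_part_in_scaled_assoc:
  fixes P :: "(real ^ 'n) set"
  assumes P: "anti_blocking_polytope P" "aff_dim P = int CARD('n)"
    and le: "\<forall>s\<in>P. y \<bullet> s \<le> c"
  obtains d where "d \<in> assoc_anti_blocking P" "pos_part y = c *\<^sub>R d"
proof (cases "c = 0")
  case True
  have nonneg: "\<forall>x\<in>P. 0 \<le> x"
    using P(1) by (simp add: anti_blocking_polytope_def)
  have "pos_part y $ i = 0" for i
  proof -
    obtain x where x: "x \<in> P" "0 < x $ i"
      using full_dim_obtains_pos_coord[OF P(2) nonneg] .
    \<comment> \<open>All summands of the inner product are nonnegative, so each single one is at
      most the sum.\<close>
    have "pos_part y $ i * x $ i \<le> pos_part y \<bullet> x"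
      unfolding inner_vec_def inner_real_def
      by (rule member_le_sum)
        (use x nonneg pos_part_nonneg[of y] in \<open>auto simp: less_eq_vec_def\<close>)
    also have "\<dots> \<le> 0"
      using pos_part_inner_le[OF P(1) le x(1)] True by simp
    finally show ?thesis
      using x(2) pos_part_nonneg[of y]
      by (metis less_eq_vec_def zero_index mult_le_0_iff not_less order_antisym)
  qed
  then have "pos_part y = 0"
    by (simp add: vec_eq_iff)
  then show ?thesis
    using that[of 0] by (simp add: assoc_anti_blocking_def)
next
  case False
  then have c: "0 < c"
    using le zero_mem_anti_blocking[OF P] by force
  show ?thesis
  proof
    show "pos_part y = c *\<^sub>R (inverse c *\<^sub>R pos_part y)"
      using c by simp
    show "inverse c *\<^sub>R pos_part y \<in> assoc_anti_blocking P"
      using c pos_part_nonneg[of y] pos_part_inner_le[OF P(1) le]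
      by (auto simp: assoc_anti_blocking_def less_eq_vec_def field_simps)
  qed
qed

text \<open>Common core of both identities: \<open>c\<close> shares the bound 1 between
  \<open>P1\<close> and \<open>P2\<close>, and the same shares become the convex weights.\<close>

lemma decompose_by_assoc_anti_blocking:
  fixes P1 P2 :: "(real ^ 'n) set"
  assumes "anti_blocking_polytope P1" "aff_dim P1 = int CARD('n)"
    and "anti_blocking_polytope P2" "aff_dim P2 = int CARD('n)"
    and "\<forall>s\<in>P1. y \<bullet> s \<le> c" "\<forall>t\<in>P2. - (y \<bullet> t) \<le> 1 - c"
  obtains d e where "d \<in> assoc_anti_blocking P1" "e \<in> assoc_anti_blocking P2"
    and "y = c *\<^sub>R d + (1 - c) *\<^sub>R (- e)" and "0 \<le> c" "c \<le> 1"
proof -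
  obtain d where d: "d \<in> assoc_anti_blocking P1" "pos_part y = c *\<^sub>R d"
    using pos_part_in_scaled_assoc assms(1,2,5) by blast
  have "\<forall>t\<in>P2. (- y) \<bullet> t \<le> 1 - c"
    using assms(6) by simp
  then obtain e where e: "e \<in> assoc_anti_blocking P2" "pos_part (- y) = (1 - c) *\<^sub>R e"
    using pos_part_in_scaled_assoc assms(3,4) by blast
  have "y = c *\<^sub>R d + (1 - c) *\<^sub>R (- e)"
    using pos_part_diff[of y] d(2) e(2) by simp
  \<comment> \<open>Evaluate the two bounds at the origin, which lies in both polytopes.\<close>
  moreover have "0 \<le> c" "c \<le> 1"
    using assms(5,6) zero_mem_anti_blocking assms(1-4) by force+
  ultimately show ?thesis
    using that d(1) e(1) by blast
qed

lemma convex_polar: "convex (polar S)"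
  by (auto simp: polar_def convex_def inner_add_left intro: convex_bound_le)

text \<open>A half-space containing \<open>S\<close> is convex and so contains the hull; polars can
  thus be tested on generators.\<close>

lemma polar_convex_hull: "polar (convex hull S) = polar S"
proof
  show "polar (convex hull S) \<subseteq> polar S"
    using hull_subset[of S convex] by (auto simp: polar_def)
  show "polar S \<subseteq> polar (convex hull S)"
  proof
    fix y assume "y \<in> polar S"
    then have "S \<subseteq> {x. y \<bullet> x \<le> 1}"
      by (auto simp: polar_def)
    then have "convex hull S \<subseteq> {x. y \<bullet> x \<le> 1}"
      by (rule hull_minimal) (rule convex_halfspace_le)
    then show "y \<in> polar (convex hull S)"
      by (auto simp: polar_def)
  qed
qed

lemma polar_minkowski_diff_anti_blocking:
  fixes P1 P2 :: "(real ^ 'n) set"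
  assumes P1: "anti_blocking_polytope P1" "aff_dim P1 = int CARD('n)"
    and P2: "anti_blocking_polytope P2" "aff_dim P2 = int CARD('n)"
  shows "polar (minkowski_diff P1 P2) =
    convex hull (assoc_anti_blocking P1 \<union> uminus ` assoc_anti_blocking P2)" (is "?L = ?R")
proof
  show "?R \<subseteq> ?L"
  proof (rule hull_minimal[where S = convex, OF subsetI convex_polar])
    fix y assume y: "y \<in> assoc_anti_blocking P1 \<union> uminus ` assoc_anti_blocking P2"
    have nonneg: "0 \<le> d \<bullet> x" if "0 \<le> d" "x \<in> P1 \<union> P2" for d x
      using that P1(1) P2(1) by (auto simp: anti_blocking_polytope_def intro!: inner_nonneg_vec)
    have "y \<bullet> (s - t) \<le> 1" if st: "s \<in> P1" "t \<in> P2" for s t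
      using y
    proof
      assume "y \<in> assoc_anti_blocking P1"
      then have "y \<bullet> s \<le> 1" "0 \<le> y \<bullet> t"
        using st nonneg by (auto simp: assoc_anti_blocking_def)
      then show ?thesis by (simp add: inner_diff_right)
    next
      assume "y \<in> uminus ` assoc_anti_blocking P2"
      then obtain e where "y = - e" "0 \<le> e" "e \<bullet> t \<le> 1"
        using st by (auto simp: assoc_anti_blocking_def)
      moreover from this have "0 \<le> e \<bullet> s"
        using st nonneg by simp
      ultimately show ?thesis by (simp add: inner_diff_right)
    qed
    then show "y \<in> ?L"
      by (auto simp: polar_def minkowski_diff_def)
  qed
  show "?L \<subseteq> ?R"
  proof
    fix y assume "y \<in> ?L"
    then have y: "y \<bullet> s \<le> 1 + y \<bullet> t" if "s \<in> P1" "t \<in> P2" for s t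
      using that by (force simp: polar_def minkowski_diff_def inner_diff_right)
    have ne: "P1 \<noteq> {}" and zero: "0 \<in> P2"
      using zero_mem_anti_blocking[OF P1] zero_mem_anti_blocking[OF P2] by auto
    \<comment> \<open>The least bound valid on \<open>P1\<close>. It is finite by taking
      \<open>t = 0\<close>, and since every \<open>1 + y \<bullet> t\<close> is an upper bound too,
      \<open>c\<close> stays below all of them.\<close>
    define c where "c = (SUP s\<in>P1. y \<bullet> s)"
    have "\<forall>s\<in>P1. y \<bullet> s \<le> c"
      unfolding c_def using y[OF _ zero] by (auto intro!: cSUP_upper bdd_aboveI2[where M = 1])
    moreover have "c \<le> 1 + y \<bullet> t" if "t \<in> P2" for t
      unfolding c_def using ne y that by (auto intro!: cSUP_least)
    then have "\<forall>t\<in>P2. - (y \<bullet> t) \<le> 1 - c"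
      by force
    ultimately obtain d e where "d \<in> assoc_anti_blocking P1" "e \<in> assoc_anti_blocking P2"
      and y_eq: "y = c *\<^sub>R d + (1 - c) *\<^sub>R (- e)" and "0 \<le> c" "c \<le> 1"
      using decompose_by_assoc_anti_blocking[OF assms] by blast
    then show "y \<in> ?R"
      unfolding y_eq by (intro convexD convex_convex_hull) (auto intro!: hull_inc)
  qed
qed

lemma polar_cayley_anti_blocking:
  fixes P1 P2 :: "(real ^ 'n) set"
  assumes P1: "anti_blocking_polytope P1" "aff_dim P1 = int CARD('n)"
    and P2: "anti_blocking_polytope P2" "aff_dim P2 = int CARD('n)"
  shows "polar (convex hull (((*\<^sub>R) 2 ` P1) \<times> {1 :: real} \<union> ((*\<^sub>R) (-2) ` P2) \<times> {-1})) =
    convex hull ((uminus ` assoc_anti_blocking P2) \<times> {1} \<union> assoc_anti_blocking P1 \<times> {-1})"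
    (is "polar (convex hull ?S) = ?R")
proof -
  have mem: "(y, h) \<in> polar ?S \<longleftrightarrow>
      (\<forall>s\<in>P1. 2 * (y \<bullet> s) + h \<le> 1) \<and> (\<forall>t\<in>P2. - 2 * (y \<bullet> t) - h \<le> 1)" for y h
    by (simp add: polar_def ball_Un Sigma_def)
  have nonneg: "0 \<le> d \<bullet> x" if "0 \<le> d" "x \<in> P1 \<union> P2" for d x
    using that P1(1) P2(1) by (auto simp: anti_blocking_polytope_def intro!: inner_nonneg_vec)
  have "?R \<subseteq> polar ?S"
  proof (rule hull_minimal[where S = convex, OF subsetI convex_polar])
    fix z :: "(real ^ 'n) \<times> real"
    assume "z \<in> (uminus ` assoc_anti_blocking P2) \<times> {1} \<union> assoc_anti_blocking P1 \<times> {-1}"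
    then consider e where "e \<in> assoc_anti_blocking P2" "z = (- e, 1)"
      | d where "d \<in> assoc_anti_blocking P1" "z = (d, -1)"
      by auto
    then show "z \<in> polar ?S"
    proof cases
      case 1
      have "(- e, 1) \<in> polar ?S"
        \<comment> \<open>The conditions reduce to \<open>0 \<le> e \<bullet> s\<close> on
          \<open>P1\<close> and \<open>e \<bullet> t \<le> 1\<close> on \<open>P2\<close>.\<close>
        unfolding mem using 1(1) nonneg[of e] by (auto simp: assoc_anti_blocking_def)
      with 1(2) show ?thesis by simp
    next
      case 2
      have "(d, -1) \<in> polar ?S"
        unfolding mem using 2(1) nonneg[of d] by (auto simp: assoc_anti_blocking_def)
      with 2(2) show ?thesis by simp
    qed
  qed
  moreover have "polar ?S \<subseteq> ?R"
  proof (rule subrelI)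
    fix y h assume "(y, h) \<in> polar ?S"
    then have yh: "\<forall>s\<in>P1. 2 * (y \<bullet> s) + h \<le> 1" "\<forall>t\<in>P2. - 2 * (y \<bullet> t) - h \<le> 1"
      unfolding mem by blast+
    \<comment> \<open>Solves \<open>h = 1 - 2 * c\<close>; the dilation by 2 is what makes the two
      bounds on \<open>y\<close> add up to exactly 1.\<close>
    define c where "c = (1 - h) / 2"
    have "\<forall>s\<in>P1. y \<bullet> s \<le> c" "\<forall>t\<in>P2. - (y \<bullet> t) \<le> 1 - c"
      using yh by (auto simp: c_def field_simps)
    then obtain d e where de: "d \<in> assoc_anti_blocking P1" "e \<in> assoc_anti_blocking P2"
      and y: "y = c *\<^sub>R d + (1 - c) *\<^sub>R (- e)" and c: "0 \<le> c" "c \<le> 1"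
      using decompose_by_assoc_anti_blocking[OF assms] by blast
    \<comment> \<open>In the last coordinate, \<open>- c + (1 - c) = h\<close>; this is why the
      heights 1 and -1 are swapped against those of \<open>P1\<close> and \<open>P2\<close>.\<close>
    have eq: "(y, h) = c *\<^sub>R (d, -1) + (1 - c) *\<^sub>R (- e, 1)"
      using y by (simp add: c_def field_simps)
    show "(y, h) \<in> ?R"
      unfolding eq using de c by (intro convexD convex_convex_hull) (auto intro!: hull_inc)
  qed
  ultimately show ?thesis
    unfolding polar_convex_hull by blast
qed

theorem theorem3p4:
  fixes P1 P2 :: "(real ^ 'n) set"
  assumes "anti_blocking_polytope P1" and "aff_dim P1 = int CARD('n)"
    and "anti_blocking_polytope P2" and "aff_dim P2 = int CARD('n)"
  shows "polar (minkowski_diff P1 P2) =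
      convex hull (assoc_anti_blocking P1 \<union> uminus ` assoc_anti_blocking P2) \<and>
    polar (convex hull (((*\<^sub>R) 2 ` P1) \<times> {1 :: real} \<union> ((*\<^sub>R) (-2) ` P2) \<times> {-1})) =
      convex hull ((uminus ` assoc_anti_blocking P2) \<times> {1} \<union> assoc_anti_blocking P1 \<times> {-1})"
  using polar_minkowski_diff_anti_blocking[OF assms] polar_cayley_anti_blocking[OF assms]
  by (rule conjI)

end
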